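(* If $G$ and $J$ are finite connected graphs, then $c_H(G \square J) \leq c_H(G) + c_H(J)$.
   Context: The Cartesian product $G \square J$ has vertex set $V(G) \times V(J)$, with $(x,y)$ adjacent to $(x',y')$ iff either $x = x'$ and $yy' \in E(J)$, or $y = y'$ and $xx' \in E(G)$. Hyperopic Cops and Robber on a graph $H$ (each vertex considered to carry a loop, so a player may stay put): the cops first occupy a multiset of vertices, then the robber chooses a vertex. In each round, each cop moves to an adjacent vertex or stays, then the robber moves to an adjacent vertex or stays. The robber always sees all cops. The cops see the robber's position except when the robber's vertex is adjacent to every vertex occupied by a cop, in which case the robber is invisible. The robber is captured when a cop occupies the robber's vertex. $c_H(H)$ is the minimum number of cops that can guarantee capture in finitely many moves. *)

theory Defs
  imports Graph_Theory.Graph_Theory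
begin

text \<open>
  Finite simple graphs are the graphs of the locale \<open>pair_graph\<close>; the edge between \<open>u\<close> and \<open>v\<close>
  is given by the two arcs \<open>(u, v)\<close> and \<open>(v, u)\<close>.
\<close>

definition cartesian_product ::
    "'a pair_pre_digraph \<Rightarrow> 'b pair_pre_digraph \<Rightarrow> ('a \<times> 'b) pair_pre_digraph"  (infixl \<open>\<box>\<close> 70)
  where
  "G \<box> J = \<lparr> pverts = pverts G \<times> pverts J,
     parcs = {((x, y), (x', y')) | x y x' y'.
        x \<in> pverts G \<and> x' \<in> pverts G \<and> y \<in> pverts J \<and> y' \<in> pverts J \<and>
        (x = x' \<and> (y, y') \<in> parcs J \<or> y = y' \<and> (x, x') \<in> parcs G)} \<rparr>"

definition step :: "'a pair_pre_digraph \<Rightarrow> 'a \<Rightarrow> 'a \<Rightarrow> bool" where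
  "step G u v \<longleftrightarrow> u \<in> pverts G \<and> v \<in> pverts G \<and> (u = v \<or> (u, v) \<in> parcs G)"

text \<open>
  The cops are labelled, a position of the cops being the list of their vertices; repetitions are
  allowed. What the cops see of a robber on \<open>v\<close> is \<open>Some v\<close>, or \<open>None\<close> if he is invisible. A robber
  sharing a vertex with a cop counts as visible here, but then he is captured and the game is over.
\<close>

definition observe :: "'a pair_pre_digraph \<Rightarrow> 'a list \<Rightarrow> 'a \<Rightarrow> 'a option" where
  "observe G c v = (if \<forall>u\<in>set c. (u, v) \<in> parcs G then None else Some v)"

text \<open>
  A strategy of the cops maps the list of all observations made so far, oldest first, to the next
  position of the cops; the empty list yields the initial position. The earlier positions of the
  cops need not be recorded, as the strategy and the observations determine them.
\<close>

type_synonym 'a strategy = "'a option list \<Rightarrow> 'a list"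

text \<open>
  In \<open>r :: nat \<Rightarrow> 'a\<close>, \<open>r 0\<close> is the vertex first chosen by the robber and \<open>r t\<close> is his vertex
  after round \<open>t\<close>. The observations up to the end of round \<open>t\<close> are made in the order of play: one
  after the initial placement, and in each round one after the move of the cops and one after the
  move of the robber.
\<close>

primrec history ::
    "'a pair_pre_digraph \<Rightarrow> 'a strategy \<Rightarrow> (nat \<Rightarrow> 'a) \<Rightarrow> nat \<Rightarrow> 'a option list" where
  "history G \<sigma> r 0 = [observe G (\<sigma> []) (r 0)]"
| "history G \<sigma> r (Suc t) =
     history G \<sigma> r t @
       [observe G (\<sigma> (history G \<sigma> r t)) (r t), observe G (\<sigma> (history G \<sigma> r t)) (r (Suc t))]"

primrec cops :: "'a pair_pre_digraph \<Rightarrow> 'a strategy \<Rightarrow> (nat \<Rightarrow> 'a) \<Rightarrow> nat \<Rightarrow> 'a list" where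
  "cops G \<sigma> r 0 = \<sigma> []"
| "cops G \<sigma> r (Suc t) = \<sigma> (history G \<sigma> r t)"

definition robber_play :: "'a pair_pre_digraph \<Rightarrow> (nat \<Rightarrow> 'a) \<Rightarrow> bool" where
  "robber_play G r \<longleftrightarrow> r 0 \<in> pverts G \<and> (\<forall>t. step G (r t) (r (Suc t)))"

definition legal_strategy :: "'a pair_pre_digraph \<Rightarrow> nat \<Rightarrow> 'a strategy \<Rightarrow> bool" where
  "legal_strategy G k \<sigma> \<longleftrightarrow>
     length (\<sigma> []) = k \<and> set (\<sigma> []) \<subseteq> pverts G \<and>
     (\<forall>r. robber_play G r \<longrightarrow>
        (\<forall>t. list_all2 (step G) (cops G \<sigma> r t) (cops G \<sigma> r (Suc t))))"

text \<open>
  A capture takes place either on a move of the robber (or on his initial choice) or on a move of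
  the cops. Plays are prolonged beyond the capture for convenience; this does not restrict the
  cops, who may simply stay put from then on.

  The robber is not given a strategy: quantifying over all his plays covers every robber, including
  one who sees the cops and anticipates their moves.
\<close>

definition captured :: "'a pair_pre_digraph \<Rightarrow> 'a strategy \<Rightarrow> (nat \<Rightarrow> 'a) \<Rightarrow> bool" where
  "captured G \<sigma> r \<longleftrightarrow> (\<exists>t. r t \<in> set (cops G \<sigma> r t) \<or> r t \<in> set (cops G \<sigma> r (Suc t)))"

definition cops_win :: "'a pair_pre_digraph \<Rightarrow> nat \<Rightarrow> bool" where
  "cops_win G k \<longleftrightarrow> (\<exists>\<sigma>. legal_strategy G k \<sigma> \<and> (\<forall>r. robber_play G r \<longrightarrow> captured G \<sigma> r))"

definition hyperopic_cop_number :: "'a pair_pre_digraph \<Rightarrow> nat"  (\<open>c\<^sub>H\<close>) where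
  "c\<^sub>H G = (LEAST k. cops_win G k)"

text \<open>The minimum exists for every finite graph: place one cop on each vertex.\<close>

lemma cops_win_card:
  assumes "finite (pverts G)"
  shows "cops_win G (card (pverts G))"
proof -
  obtain xs where xs: "set xs = pverts G" "distinct xs"
    using finite_distinct_list[OF assms] by blast
  have c: "cops G (\<lambda>_. xs) r t = xs" for r t
    by (cases t) simp_all
  have "legal_strategy G (card (pverts G)) (\<lambda>_. xs)"
    using xs unfolding legal_strategy_def c
    by (auto simp: distinct_card[symmetric] step_def intro!: list.rel_refl_strong)
  moreover have "captured G (\<lambda>_. xs) r" if "robber_play G r" for r
    using that xs unfolding captured_def c robber_play_def by blast
  ultimately show ?thesis
    unfolding cops_win_def by blast
qed

end

theory Submission
  imports Defs "HOL-Library.Infinite_Set"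
begin

text \<open>
  Team A has \<open>c\<^sub>H G\<close> cops, all with the same second coordinate \<open>u\<close>; team B has
  \<open>c\<^sub>H J\<close> cops, all with the same first coordinate \<open>v\<close>. While the robber \<open>(x, y)\<close> is not in the
  row \<open>u\<close>, team A moves towards this row; whenever he is in it after his move, team A plays a round of
  a winning strategy of \<open>G\<close> against \<open>x\<close>. A robber leaving the row is visible, and team A follows
  him, so the game in \<open>G\<close> is only interrupted, with \<open>x\<close> unchanged. Team B does the same with the
  column \<open>v\<close> and a strategy of \<open>J\<close>. If a team plays infinitely many rounds, it wins; otherwise the
  sum of the distances from \<open>u\<close> to \<open>y\<close> and from \<open>v\<close> to \<open>x\<close> eventually decreases forever.

  An invisible robber is adjacent to all cops. Unless all cops are on one vertex, this determines,
  together with the earlier observations, whether he is in the row \<open>u\<close> and whether he is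
  in the column \<open>v\<close>, and his position if he is in neither. A team in whose row or column he is then
  needs no more information, as he is invisible in its simulated game too, and the other team can
  wait.
\<close>

section \<open>Histories and strategies\<close>

text \<open>The counterpart of \<open>history\<close> for cops given by a sequence of positions
  instead of a strategy; \<open>D (Suc t)\<close> is observed both before and after the robber
  leaves \<open>r t\<close>.\<close>

primrec observations ::
    "'a pair_pre_digraph \<Rightarrow> (nat \<Rightarrow> 'a list) \<Rightarrow> (nat \<Rightarrow> 'a) \<Rightarrow> nat \<Rightarrow> 'a option list" where
  "observations G D r 0 = [observe G (D 0) (r 0)]"
| "observations G D r (Suc t) =
     observations G D r t @ [observe G (D (Suc t)) (r t), observe G (D (Suc t)) (r (Suc t))]"

text \<open>The first clause excludes captures by a move of the robber up to round \<open>t\<close>,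
  the second those by a move of the cops.\<close>

definition uncaught :: "(nat \<Rightarrow> 'a list) \<Rightarrow> (nat \<Rightarrow> 'a) \<Rightarrow> nat \<Rightarrow> bool" where
  "uncaught D r t \<longleftrightarrow> (\<forall>s\<le>t. r s \<notin> set (D s)) \<and> (\<forall>s<t. r s \<notin> set (D (Suc s)))"

lemma uncaught_mono: "uncaught D r t \<Longrightarrow> s \<le> t \<Longrightarrow> uncaught D r s"
  unfolding uncaught_def by auto

lemma uncaught_Suc:
  "uncaught D r (Suc t) \<longleftrightarrow>
     uncaught D r t \<and> r t \<notin> set (D (Suc t)) \<and> r (Suc t) \<notin> set (D (Suc t))"
  unfolding uncaught_def by (auto simp: le_Suc_eq less_Suc_eq)

lemma uncaught_0: "uncaught D r 0 \<longleftrightarrow> r 0 \<notin> set (D 0)"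
  unfolding uncaught_def by auto

lemma observations_cong:
  assumes "\<And>s. s \<le> t \<Longrightarrow> D s = E s"
  shows "observations G D r t = observations G E r t"
  using assms by (induction t) auto

lemma length_observations: "length (observations G D r t) = Suc (2 * t)"
  by (induction t) auto

lemma observations_SucD:
  assumes "observations G D r (Suc t) = observations G E r' (Suc t)"
  shows "observations G D r t = observations G E r' t"
    and "observe G (D (Suc t)) (r t) = observe G (E (Suc t)) (r' t)"
    and "observe G (D (Suc t)) (r (Suc t)) = observe G (E (Suc t)) (r' (Suc t))"
  using assms by (auto simp: length_observations)

lemma observe_SomeD: "observe G c v = Some w \<Longrightarrow> w = v"
  by (auto simp: observe_def split: if_splits)

lemma observe_Some_eq: "observe G c v = observe G c w \<Longrightarrow> observe G c v \<noteq> None \<Longrightarrow> v = w"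
  by (auto simp: observe_def split: if_splits)

lemma observe_cop:
  assumes "\<And>u. (u, u) \<notin> parcs G" "v \<in> set c"
  shows "observe G c v = Some v"
  using assms by (auto simp: observe_def)

lemma observe_None_iff: "observe G c v = None \<longleftrightarrow> (\<forall>u\<in>set c. (u, v) \<in> parcs G)"
  by (auto simp: observe_def)

lemma step_refl: "u \<in> pverts G \<Longrightarrow> step G u u"
  by (simp add: step_def)

lemma list_all2_step_subset: "list_all2 (step G) xs ys \<Longrightarrow> set ys \<subseteq> pverts G"
  by (auto simp: list_all2_conv_all_nth step_def in_set_conv_nth)

section \<open>From positions depending on the play to a strategy\<close>

text \<open>\<open>C\<close> is only controlled before the capture, whereas legality of a strategy
  concerns the whole infinite play; stopping the cops at the capture bridges this.\<close>

primrec freeze ::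
    "((nat \<Rightarrow> 'a) \<Rightarrow> nat \<Rightarrow> 'a list) \<Rightarrow> (nat \<Rightarrow> 'a) \<Rightarrow> nat \<Rightarrow> 'a list" where
  "freeze C r 0 = C r 0"
| "freeze C r (Suc t) = (if uncaught (C r) r t then C r (Suc t) else freeze C r t)"

lemma freeze_uncaught:
  assumes "uncaught (C r) r t" "s \<le> Suc t"
  shows "freeze C r s = C r s"
proof (cases s)
  case (Suc i)
  then show ?thesis using uncaught_mono[OF assms(1), of i] assms(2) by simp
qed simp

text \<open>
  The cops may be described by their positions as a function of the whole play of the robber, as
  long as equal observations force equal moves. After the capture, which the cops notice because
  there are no loops, they stay put.
\<close>

lemma cops_win_if_nonanticipating:
  assumes loopfree: "\<And>u. (u, u) \<notin> parcs G"
    and init: "\<And>r. C r 0 = c0" "length c0 = k" "set c0 \<subseteq> pverts G"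
    and moves: "\<And>r t. robber_play G r \<Longrightarrow> uncaught (C r) r t \<Longrightarrow>
      list_all2 (step G) (C r t) (C r (Suc t))"
    and nonanticipating: "\<And>r r' t. robber_play G r \<Longrightarrow> robber_play G r' \<Longrightarrow>
      uncaught (C r) r t \<Longrightarrow> uncaught (C r') r' t \<Longrightarrow>
      observations G (C r) r t = observations G (C r') r' t \<Longrightarrow> C r (Suc t) = C r' (Suc t)"
    and win: "\<And>r. robber_play G r \<Longrightarrow> \<exists>t. \<not> uncaught (C r) r t"
  shows "cops_win G k"
proof -
  let ?F = "freeze C"
  have F_step: "list_all2 (step G) (?F r t) (?F r (Suc t)) \<and> set (?F r t) \<subseteq> pverts G"
    if r: "robber_play G r" for r t
  proof (induction t)
    case 0
    then show ?case
      using moves[OF r, of 0] init by (auto intro!: list.rel_refl_strong step_refl)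
  next
    case (Suc t)
    then have sub: "set (?F r (Suc t)) \<subseteq> pverts G"
      using list_all2_step_subset by blast
    show ?case
    proof (cases "uncaught (C r) r (Suc t)")
      case True
      then show ?thesis
        using moves[OF r True] sub freeze_uncaught[where C = C, OF True, of "Suc t"]
          freeze_uncaught[where C = C, OF True, of "Suc (Suc t)"] by simp
    next
      case False
      then show ?thesis
        using sub by (auto intro!: list.rel_refl_strong step_refl simp del: freeze.simps(2)
            simp add: freeze.simps(2)[of C r "Suc t"])
    qed
  qed
  \<comment> \<open>Whether the capture has happened must be carried through the induction, since
    \<open>freeze\<close> consults it.\<close>
  have F_det: "(uncaught (C r) r t \<longleftrightarrow> uncaught (C r') r' t) \<and>
      ?F r (Suc t) = ?F r' (Suc t) \<and> ?F r t = ?F r' t"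
    if r: "robber_play G r" "robber_play G r'"
      and "observations G (?F r) r t = observations G (?F r') r' t" for r r' t
    using that(3)
  proof (induction t)
    case 0
    have "observe G c0 (r 0) = observe G c0 (r' 0)"
      using 0 by (simp add: init)
    \<comment> \<open>Without loops a robber on the vertex of a cop is not adjacent to that cop,
      hence visible, so the observation reveals the capture.\<close>
    then have "r 0 \<in> set c0 \<longleftrightarrow> r' 0 \<in> set c0"
      using observe_cop[OF loopfree, of _ c0] observe_SomeD by metis
    then have "uncaught (C r) r 0 \<longleftrightarrow> uncaught (C r') r' 0"
      by (simp add: uncaught_0 init)
    moreover have "C r (Suc 0) = C r' (Suc 0)" if "uncaught (C r) r 0" "uncaught (C r') r' 0"
      using nonanticipating[OF r that] 0 by (simp add: init)
    ultimately show ?case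
      by (auto simp: init)
  next
    case (Suc t)
    note D = observations_SucD[OF Suc.prems]
    have IH: "uncaught (C r) r t \<longleftrightarrow> uncaught (C r') r' t" "?F r (Suc t) = ?F r' (Suc t)"
      using Suc.IH D(1) by auto
    show ?case
    proof (cases "uncaught (C r) r t")
      case False
      then have "\<not> uncaught (C r) r (Suc t)" "\<not> uncaught (C r') r' (Suc t)"
        using IH(1) by (auto simp: uncaught_Suc)
      then show ?thesis
        using IH(2) by (simp del: freeze.simps(2) add: freeze.simps(2)[of C _ "Suc t"])
    next
      case True
      then have True': "uncaught (C r') r' t"
        using IH(1) by simp
      define c where "c = ?F r (Suc t)"
      have c: "C r (Suc t) = c" "C r' (Suc t) = c" "?F r (Suc t) = c" "?F r' (Suc t) = c"
        unfolding c_def using True True' IH(2) by simp_all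
      have obs: "observe G c (r t) = observe G c (r' t)"
        "observe G c (r (Suc t)) = observe G c (r' (Suc t))"
        using D(2,3) unfolding c by simp_all
      have "r t \<in> set c \<longleftrightarrow> r' t \<in> set c" "r (Suc t) \<in> set c \<longleftrightarrow> r' (Suc t) \<in> set c"
        using obs observe_cop[OF loopfree, of _ c] observe_SomeD by metis+
      then have un: "uncaught (C r) r (Suc t) \<longleftrightarrow> uncaught (C r') r' (Suc t)"
        using True True' c by (simp add: uncaught_Suc)
      have "observations G (C r) r (Suc t) = observations G (?F r) r (Suc t)"
        "observations G (C r') r' (Suc t) = observations G (?F r') r' (Suc t)"
        using freeze_uncaught[where C = C, OF True] freeze_uncaught[where C = C, OF True']
        by (metis observations_cong)+
      then have "C r (Suc (Suc t)) = C r' (Suc (Suc t))"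
        if "uncaught (C r) r (Suc t)"
        using nonanticipating[OF r that] un that Suc.prems by simp
      then show ?thesis
        using un IH(2) by (simp del: freeze.simps(2) add: freeze.simps(2)[of C _ "Suc t"])
    qed
  qed
  \<comment> \<open>All plays that produce \<open>h\<close> agree on the next position by
    \<open>F_det\<close>, so the choice is forced.\<close>
  define \<sigma> where "\<sigma> h = (if h = [] then c0 else
      SOME c. \<exists>r t. robber_play G r \<and> observations G (?F r) r t = h \<and> c = ?F r (Suc t))" for h
  have \<sigma>: "\<sigma> (observations G (?F r) r t) = ?F r (Suc t)" if r: "robber_play G r" for r t
  proof -
    have ne: "observations G (?F r) r t \<noteq> []"
      using length_observations[of G "?F r" r t] by auto
    have "?F r' (Suc t') = ?F r (Suc t)"
      if r': "robber_play G r'" and eq: "observations G (?F r') r' t' = observations G (?F r) r t"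
      for r' t'
    proof -
      \<comment> \<open>After round \<open>t\<close> there are \<open>2 * t + 1\<close>
        observations, so the list itself tells the round.\<close>
      have "t' = t"
        using arg_cong[OF eq, of length] by (simp add: length_observations)
      then show ?thesis
        using F_det[OF r' r] eq by blast
    qed
    then have "(SOME c. \<exists>r' t'. robber_play G r' \<and>
        observations G (?F r') r' t' = observations G (?F r) r t \<and> c = ?F r' (Suc t')) = ?F r (Suc t)"
      using r by (intro some_equality) blast+
    then show ?thesis
      unfolding \<sigma>_def using ne by simp
  qed
  have hist: "history G \<sigma> r t = observations G (?F r) r t \<and> cops G \<sigma> r t = ?F r t"
    if r: "robber_play G r" for r t
  proof (induction t)
    case 0
    then show ?case by (simp add: \<sigma>_def init)
  next
    case (Suc t)
    then show ?case
      using \<sigma>[OF r, of t] by (simp del: freeze.simps)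
  qed
  have "legal_strategy G k \<sigma>"
  proof -
    have "\<sigma> [] = c0" by (simp add: \<sigma>_def)
    then show ?thesis
      unfolding legal_strategy_def using init hist F_step by (simp del: cops.simps freeze.simps)
  qed
  moreover have "captured G \<sigma> r" if r: "robber_play G r" for r
  proof -
    define t where "t = (LEAST t. \<not> uncaught (C r) r t)"
    have t: "\<not> uncaught (C r) r t"
      unfolding t_def using win[OF r] by (rule LeastI_ex)
    show ?thesis
    proof (cases t)
      case 0
      then have "r 0 \<in> set (cops G \<sigma> r 0)"
        using t hist[OF r, of 0] by (simp add: uncaught_0)
      then show ?thesis unfolding captured_def by blast
    next
      case (Suc s)
      then have s: "uncaught (C r) r s"
        using not_less_Least[of s "\<lambda>t. \<not> uncaught (C r) r t"] unfolding t_def by auto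
      then have "cops G \<sigma> r (Suc s) = C r (Suc s)"
        using hist[OF r, of "Suc s"] by (simp del: cops.simps)
      moreover have "r s \<in> set (C r (Suc s)) \<or> r (Suc s) \<in> set (C r (Suc s))"
        using t s unfolding Suc uncaught_Suc by simp
      ultimately show ?thesis unfolding captured_def by metis
    qed
  qed
  ultimately show ?thesis
    unfolding cops_win_def by blast
qed

section \<open>Games interrupted by idle rounds\<close>

lemma history_cong:
  assumes "\<And>s. s \<le> t \<Longrightarrow> r s = r' s"
  shows "history G \<sigma> r t = history G \<sigma> r' t"
  using assms by (induction t) auto

lemma history_not_Nil: "history G \<sigma> r t \<noteq> []"
  by (cases t) auto

lemma legal_strategy_cops:
  assumes "legal_strategy G k \<sigma>" "robber_play G r"
  shows "length (cops G \<sigma> r t) = k \<and> set (cops G \<sigma> r t) \<subseteq> pverts G"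
proof (induction t)
  case 0
  then show ?case using assms unfolding legal_strategy_def by simp
next
  case (Suc t)
  have "list_all2 (step G) (cops G \<sigma> r t) (cops G \<sigma> r (Suc t))"
    using assms unfolding legal_strategy_def by blast
  with Suc show ?case
    using list_all2_lengthD list_all2_step_subset by (metis (no_types, lifting))
qed

text \<open>One round against a robber moving from \<open>w\<close> to \<open>v\<close>. The empty
  list stands for a game not yet begun: then \<open>v\<close> is the initial choice of the robber
  and \<open>w\<close> is ignored.\<close>

definition extend_history ::
    "'a pair_pre_digraph \<Rightarrow> 'a strategy \<Rightarrow> 'a option list \<Rightarrow> 'a \<Rightarrow> 'a \<Rightarrow> 'a option list" where
  "extend_history G \<sigma> H w v =
     (if H = [] then [observe G (\<sigma> []) v] else H @ [observe G (\<sigma> H) w, observe G (\<sigma> H) v])"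

text \<open>
  A game played only in the rounds \<open>t\<close> with \<open>act t\<close>, against a robber who moves only in these
  rounds once the game has begun.
\<close>

locale intermittent_game =
  fixes G :: "'a pair_pre_digraph" and k :: nat and \<sigma> :: "'a strategy"
    and X :: "nat \<Rightarrow> 'a" and act :: "nat \<Rightarrow> bool" and H :: "nat \<Rightarrow> 'a option list"
  assumes legal: "legal_strategy G k \<sigma>"
    and X_step: "\<And>t. step G (X t) (X (Suc t))"
    and H_0: "H 0 = []"
    and H_Suc: "\<And>t. H (Suc t) =
      (if act t then extend_history G \<sigma> (H t) (X (t - 1)) (X t) else H t)"
begin

lemma X_verts: "X t \<in> pverts G"
  using X_step[of t] by (simp add: step_def)

lemma step_pred: "step G (X (t - 1)) (X t)"
  using X_step[of "t - 1"] by (cases t) (auto simp: step_def X_verts)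

text \<open>Deleting the idle rounds leaves a genuine play: an active round appends
  \<open>X t\<close> to it, and an idle one does not change \<open>X\<close>. As \<open>H t\<close>
  records the rounds before \<open>t\<close>, that play has reached
  \<open>X (t - 1)\<close>.\<close>

lemma H_is_history:
  assumes "\<And>s. s < t \<Longrightarrow> H s \<noteq> [] \<Longrightarrow> \<not> act s \<Longrightarrow> X s = X (s - 1)"
  shows "H t = [] \<or> (\<exists>\<rho> i. robber_play G \<rho> \<and> H t = history G \<sigma> \<rho> i \<and> \<rho> i = X (t - 1))"
  using assms
proof (induction t)
  case 0
  then show ?case by (simp add: H_0)
next
  case (Suc t)
  then consider "H t = []"
    | \<rho> i where "robber_play G \<rho>" "H t = history G \<sigma> \<rho> i" "\<rho> i = X (t - 1)"
    by fastforce
  then show ?case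
  proof cases
    case 1
    show ?thesis
    proof (cases "act t")
      case True
      then have "H (Suc t) = history G \<sigma> (\<lambda>_. X t) 0"
        using 1 by (simp add: H_Suc extend_history_def)
      moreover have "robber_play G (\<lambda>_. X t)"
        by (simp add: robber_play_def X_verts step_refl)
      ultimately show ?thesis
        by (intro disjI2 exI[of _ "\<lambda>_. X t"] exI[of _ 0]) simp
    qed (simp add: H_Suc 1)
  next
    case (2 \<rho> i)
    show ?thesis
    proof (cases "act t")
      case False
      then have "X t = X (t - 1)"
        using Suc.prems[of t] 2(2) history_not_Nil[of G \<sigma> \<rho> i] by simp
      then show ?thesis using 2 False by (auto simp: H_Suc)
    next
      case True
      \<comment> \<open>Only the first \<open>Suc i\<close> rounds matter; staying on
        \<open>X t\<close> afterwards makes the play infinite.\<close>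
      define \<rho>' where "\<rho>' j = (if j \<le> i then \<rho> j else X t)" for j
      have "step G (\<rho>' j) (\<rho>' (Suc j))" for j
        using 2(1,3) step_pred[of t] X_verts unfolding \<rho>'_def robber_play_def
        by (cases "j = i") (auto simp: step_refl)
      then have "robber_play G \<rho>'"
        using 2(1) by (simp add: robber_play_def \<rho>'_def)
      moreover have h: "history G \<sigma> \<rho>' i = H t"
        unfolding 2(2) by (rule history_cong) (simp add: \<rho>'_def)
      have "\<rho>' i = X (t - 1)" "\<rho>' (Suc i) = X t"
        by (simp_all add: \<rho>'_def 2(3))
      then have "H (Suc t) = history G \<sigma> \<rho>' (Suc i)"
        using True 2(2) history_not_Nil[of G \<sigma> \<rho> i]
        by (simp add: h H_Suc extend_history_def)
      moreover have "\<rho>' (Suc i) = X (Suc t - 1)"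
        by (simp add: \<rho>'_def)
      ultimately show ?thesis
        by blast
    qed
  qed
qed

lemma position_verts:
  assumes "\<And>s. s < t \<Longrightarrow> H s \<noteq> [] \<Longrightarrow> \<not> act s \<Longrightarrow> X s = X (s - 1)"
  shows "length (\<sigma> (H t)) = k \<and> set (\<sigma> (H t)) \<subseteq> pverts G"
  using H_is_history[OF assms]
proof
  assume "H t = []"
  then show ?thesis using legal unfolding legal_strategy_def by simp
next
  assume "\<exists>\<rho> i. robber_play G \<rho> \<and> H t = history G \<sigma> \<rho> i \<and> \<rho> i = X (t - 1)"
  then show ?thesis using legal_strategy_cops[OF legal] by (metis cops.simps(2))
qed

lemma position_step:
  assumes "\<And>s. s \<le> t \<Longrightarrow> H s \<noteq> [] \<Longrightarrow> \<not> act s \<Longrightarrow> X s = X (s - 1)"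
  shows "list_all2 (step G) (\<sigma> (H t)) (\<sigma> (H (Suc t)))"
proof (cases "act t")
  case False
  then show ?thesis
    using position_verts[of t] assms by (auto simp: H_Suc intro!: list.rel_refl_strong step_refl)
next
  case True
  then have "H (Suc t) \<noteq> []"
    by (simp add: H_Suc extend_history_def)
  then obtain \<rho> i where \<rho>: "robber_play G \<rho>" "H (Suc t) = history G \<sigma> \<rho> i"
    using H_is_history[of "Suc t"] assms by (auto simp: less_Suc_eq_le)
  \<comment> \<open>Removing the last active round gives the history on which the cops based their
    position in round \<open>i\<close>.\<close>
  have "H t = (case i of 0 \<Rightarrow> [] | Suc j \<Rightarrow> history G \<sigma> \<rho> j)"
    using \<rho>(2) True history_not_Nil[of G \<sigma> \<rho>]
    by (cases i) (auto simp: H_Suc extend_history_def split: if_splits)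
  then have "cops G \<sigma> \<rho> i = \<sigma> (H t)"
    by (cases i) auto
  then show ?thesis
    using legal \<rho> unfolding legal_strategy_def by (metis cops.simps(2))
qed

text \<open>The positions at the active rounds \<open>e 0 < e 1 < ...\<close> form an infinite play
  of \<open>G\<close>; the winning strategy captures it in some round \<open>i\<close>, which is the
  real round \<open>e i\<close>.\<close>

lemma capture_if_infinite:
  assumes idle: "\<And>s. H s \<noteq> [] \<Longrightarrow> \<not> act s \<Longrightarrow> X s = X (s - 1)"
    and inf: "infinite {t. act t}"
    and win: "\<And>\<rho>. robber_play G \<rho> \<Longrightarrow> captured G \<sigma> \<rho>"
  shows "\<exists>t. act t \<and> (X t \<in> set (\<sigma> (H t)) \<or> X t \<in> set (\<sigma> (H (Suc t))))"
proof -
  define e where "e = enumerate {t. act t}"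
  define \<rho> where "\<rho> i = X (e i)" for i
  have act_e: "act (e i)" for i
    using enumerate_in_set[OF inf] by (simp add: e_def)
  have less_e: "e i < e (Suc i)" for i
    using enumerate_step[OF inf] by (simp add: e_def)
  have gap: "\<not> act s" if "e i < s" "s < e (Suc i)" for i s
    using that not_less_Least[of s "\<lambda>s. s \<in> {t. act t} \<and> enumerate {t. act t} i < s"]
    unfolding e_def enumerate_Suc''[OF inf] by auto
  have H_e0: "H s = []" if "s \<le> e 0" for s
    using that
  proof (induction s)
    case (Suc s)
    then have "\<not> act s"
      using not_less_Least[of s act] by (simp add: e_def enumerate_0)
    then show ?case using Suc by (simp add: H_Suc)
  qed (simp add: H_0)
  \<comment> \<open>Nothing changes between consecutive active rounds, so the robber starts round
    \<open>e (Suc i)\<close> from where round \<open>e i\<close> left him.\<close>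
  have between: "H s = H (Suc (e i)) \<and> X (s - 1) = X (e i)"
    if "Suc (e i) \<le> s" "s \<le> e (Suc i)" for s i
    using that
  proof (induction s rule: dec_induct)
    case (step s)
    then have "\<not> act s" using gap[of i s] by simp
    moreover have "H s \<noteq> []"
      using step act_e[of i] by (auto simp: H_Suc[of "e i"] extend_history_def)
    ultimately show ?case using step idle[of s] by (simp add: H_Suc)
  qed simp
  have at_e: "H (e (Suc i)) = H (Suc (e i))" "X (e (Suc i) - 1) = \<rho> i" for i
    using between[of i "e (Suc i)"] less_e[of i] by (auto simp: \<rho>_def)
  have hist: "H (Suc (e i)) = history G \<sigma> \<rho> i" for i
  proof (induction i)
    case 0
    then show ?case
      using act_e[of 0] H_e0 by (simp add: H_Suc extend_history_def \<rho>_def)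
  next
    case (Suc i)
    have "H (Suc (e i)) \<noteq> []"
      using act_e[of i] by (simp add: H_Suc extend_history_def)
    then show ?case
      using act_e[of "Suc i"] at_e[of i] Suc
      by (simp add: H_Suc[of "e (Suc i)"] extend_history_def) (simp add: \<rho>_def)
  qed
  have "step G (\<rho> i) (\<rho> (Suc i))" for i
    using step_pred[of "e (Suc i)"] at_e(2)[of i] by (simp add: \<rho>_def)
  then have "robber_play G \<rho>"
    by (simp add: robber_play_def \<rho>_def X_verts)
  then obtain i where i: "\<rho> i \<in> set (cops G \<sigma> \<rho> i) \<or> \<rho> i \<in> set (cops G \<sigma> \<rho> (Suc i))"
    using win unfolding captured_def by blast
  have "cops G \<sigma> \<rho> i = \<sigma> (H (e i))"
    using H_e0 at_e hist by (cases i) auto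
  then show ?thesis
    using i hist[of i] act_e[of i] by (intro exI[of _ "e i"]) (simp add: \<rho>_def)
qed

end

section \<open>Moving towards a vertex\<close>

definition gdist :: "'a pair_pre_digraph \<Rightarrow> 'a \<Rightarrow> 'a \<Rightarrow> nat" where
  "gdist G u v = (LEAST n. (u, v) \<in> parcs G ^^ n)"

text \<open>Which first step of a shortest path is taken is irrelevant, but it has to be a function
  of \<open>u\<close> and \<open>v\<close> alone, so that equal knowledge leads to equal
  moves.\<close>

definition toward :: "'a pair_pre_digraph \<Rightarrow> 'a \<Rightarrow> 'a \<Rightarrow> 'a" where
  "toward G u v = (SOME w. (u, w) \<in> parcs G \<and> Suc (gdist G w v) = gdist G u v)"

locale connected_graph = pair_graph G for G :: "'a pair_pre_digraph" +
  assumes conn: "Digraph_Component.connected (with_proj G)"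
begin

lemma no_loop: "(u, u) \<notin> parcs G"
  using pair_no_loops by fastforce

lemma verts_nonempty: "pverts G \<noteq> {}"
  using conn unfolding Digraph_Component.connected_def strongly_connected_def
  by (simp add: mk_symmetric_def)

lemma relpow_exists: "u \<in> pverts G \<Longrightarrow> v \<in> pverts G \<Longrightarrow> \<exists>n. (u, v) \<in> parcs G ^^ n"
proof -
  assume "u \<in> pverts G" "v \<in> pverts G"
  then have "(u, v) \<in> rtrancl_on (pverts G) (arcs_ends (mk_symmetric (with_proj G)))"
    using conn unfolding Digraph_Component.connected_def strongly_connected_def reachable_def
    by (simp add: mk_symmetric_def)
  \<comment> \<open>Connectedness is defined through the symmetric closure, which adds no arcs
    here.\<close>
  moreover have "arcs_ends (mk_symmetric (with_proj G)) = parcs G"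
    using arcs_symmetric unfolding mk_symmetric_def by (auto simp: arcs_ends_conv)
  ultimately have "(u, v) \<in> (parcs G)\<^sup>*"
    by (simp add: rtrancl_on_rtranclI)
  then show ?thesis by (rule rtrancl_imp_relpow)
qed

lemma gdist_relpow: "u \<in> pverts G \<Longrightarrow> v \<in> pverts G \<Longrightarrow> (u, v) \<in> parcs G ^^ gdist G u v"
  unfolding gdist_def using relpow_exists by (rule LeastI_ex)

lemma gdist_le: "(u, v) \<in> parcs G ^^ n \<Longrightarrow> gdist G u v \<le> n"
  unfolding gdist_def by (rule Least_le)

lemma gdist_arc: "(v, w) \<in> parcs G \<Longrightarrow> u \<in> pverts G \<Longrightarrow> gdist G u w \<le> Suc (gdist G u v)"
  using gdist_relpow[of u v] wellformed' by (intro gdist_le) auto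

lemma gdist_zero_iff: "u \<in> pverts G \<Longrightarrow> v \<in> pverts G \<Longrightarrow> gdist G u v = 0 \<longleftrightarrow> u = v"
  using gdist_relpow[of u v] gdist_le[of u v 0] by auto

lemma toward:
  assumes "u \<in> pverts G" "v \<in> pverts G" "u \<noteq> v"
  shows "(u, toward G u v) \<in> parcs G" "Suc (gdist G (toward G u v) v) = gdist G u v"
proof -
  have "\<exists>w. (u, w) \<in> parcs G \<and> Suc (gdist G w v) = gdist G u v"
  proof -
    obtain n where n: "gdist G u v = Suc n"
      using gdist_zero_iff[OF assms(1,2)] assms(3) not0_implies_Suc by auto
    then obtain w where w: "(u, w) \<in> parcs G" "(w, v) \<in> parcs G ^^ n"
      using gdist_relpow[OF assms(1,2)] by (metis relpow_Suc_D2)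
    have "gdist G w v \<le> n" using w(2) by (rule gdist_le)
    moreover have "w \<in> pverts G" using w(1) wellformed' by blast
    then have "(u, v) \<in> parcs G ^^ Suc (gdist G w v)"
      using w(1) gdist_relpow[OF _ assms(2)] by (blast intro: relpow_Suc_I2)
    then have "Suc n \<le> Suc (gdist G w v)" using gdist_le n by metis
    ultimately show ?thesis using w n by auto
  qed
  from someI_ex[OF this] show "(u, toward G u v) \<in> parcs G"
    "Suc (gdist G (toward G u v) v) = gdist G u v"
    unfolding toward_def by blast+
qed

lemma toward_in_verts: "u \<in> pverts G \<Longrightarrow> v \<in> pverts G \<Longrightarrow> u \<noteq> v \<Longrightarrow> toward G u v \<in> pverts G"
  using toward(1) wellformed' by blast

text \<open>Lets a team regain in one move a robber who has just stepped out of its row or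
  column.\<close>

lemma toward_adjacent:
  assumes "(u, v) \<in> parcs G"
  shows "toward G u v = v"
proof -
  have uv: "u \<in> pverts G" "v \<in> pverts G" "u \<noteq> v"
    using assms wellformed' no_loop by blast+
  have "gdist G u v \<le> 1" using assms by (intro gdist_le) auto
  then have "gdist G (toward G u v) v = 0" using toward(2)[OF uv] by simp
  then show ?thesis using gdist_zero_iff toward_in_verts uv by blast
qed

lemma toward_neq: "u \<in> pverts G \<Longrightarrow> v \<in> pverts G \<Longrightarrow> u \<noteq> v \<Longrightarrow> toward G u v \<noteq> u"
  using toward(1) no_loop by metis

lemma hyperopic_cop_number_winning: "cops_win G (c\<^sub>H G)"
  unfolding hyperopic_cop_number_def
  by (rule LeastI_ex) (use cops_win_card[OF pair_finite_verts] in blast)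

end


section \<open>The two teams\<close>

lemma cartesian_product_verts: "pverts (G \<box> J) = pverts G \<times> pverts J"
  by (simp add: cartesian_product_def)

locale two_teams = G: connected_graph G + J: connected_graph J
  for G :: "'a pair_pre_digraph" and J :: "'b pair_pre_digraph" +
  fixes k m :: nat and \<sigma> :: "'a strategy" and \<tau> :: "'b strategy"
  assumes \<sigma>_legal: "legal_strategy G k \<sigma>" and \<sigma>_win: "\<And>r. robber_play G r \<Longrightarrow> captured G \<sigma> r"
    and \<tau>_legal: "legal_strategy J m \<tau>" and \<tau>_win: "\<And>r. robber_play J r \<Longrightarrow> captured J \<tau> r"
begin

abbreviation N where "N \<equiv> G \<box> J"

lemma arc_iff: "((a, b), (x, y)) \<in> parcs N \<longleftrightarrow>
    a = x \<and> a \<in> pverts G \<and> (b, y) \<in> parcs J \<or> b = y \<and> b \<in> pverts J \<and> (a, x) \<in> parcs G"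
  using G.wellformed' J.wellformed' by (auto simp: cartesian_product_def)

lemma step_iff: "step N p q \<longleftrightarrow>
    step G (fst p) (fst q) \<and> step J (snd p) (snd q) \<and> (fst p = fst q \<or> snd p = snd q)"
  by (cases p; cases q) (auto simp: step_def cartesian_product_verts arc_iff)

lemma N_no_loop: "(p, p) \<notin> parcs N"
  using G.no_loop J.no_loop by (cases p) (auto simp: arc_iff)

text \<open>A reference cop for each team: until its game begins, team A has a cop on
  \<open>a0\<close> in its row and team B has one on \<open>b0\<close> in its column. Adjacency to
  these two cops locates an invisible robber.\<close>

definition a0 where "a0 = hd (\<sigma> [])"
definition b0 where "b0 = hd (\<tau> [])"

text \<open>Team A starts in row \<open>b0\<close>, so \<open>v0 \<noteq> a0\<close> separates the
  two reference cops initially. If this is impossible, \<open>G\<close> has one vertex and the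
  robber is always in the column.\<close>

definition v0 where
  "v0 = (if \<exists>v\<in>pverts G. v \<noteq> a0 then SOME v. v \<in> pverts G \<and> v \<noteq> a0 else a0)"

lemma k_pos: "0 < k"
proof (rule ccontr)
  assume "\<not> 0 < k"
  obtain v where "v \<in> pverts G" using G.verts_nonempty by blast
  then have "robber_play G (\<lambda>_. v)" by (simp add: robber_play_def step_refl)
  then show False
    using \<open>\<not> 0 < k\<close> \<sigma>_win legal_strategy_cops[OF \<sigma>_legal] unfolding captured_def
    by (metis gr0I length_0_conv list.set(1) empty_iff)
qed

lemma m_pos: "0 < m"
proof (rule ccontr)
  assume "\<not> 0 < m"
  obtain v where "v \<in> pverts J" using J.verts_nonempty by blast
  then have "robber_play J (\<lambda>_. v)" by (simp add: robber_play_def step_refl)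
  then show False
    using \<open>\<not> 0 < m\<close> \<tau>_win legal_strategy_cops[OF \<tau>_legal] unfolding captured_def
    by (metis gr0I length_0_conv list.set(1) empty_iff)
qed

lemma initial:
  "length (\<sigma> []) = k" "set (\<sigma> []) \<subseteq> pverts G" "length (\<tau> []) = m" "set (\<tau> []) \<subseteq> pverts J"
  using \<sigma>_legal \<tau>_legal unfolding legal_strategy_def by auto

lemma a0: "a0 \<in> set (\<sigma> [])" "a0 \<in> pverts G"
  using initial k_pos unfolding a0_def by (metis hd_in_set length_greater_0_conv subsetD)+

lemma b0: "b0 \<in> set (\<tau> [])" "b0 \<in> pverts J"
  using initial m_pos unfolding b0_def by (metis hd_in_set length_greater_0_conv subsetD)+

lemma v0: "v0 \<in> pverts G"
proof (cases "\<exists>v\<in>pverts G. v \<noteq> a0")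
  case True
  then have "\<exists>v. v \<in> pverts G \<and> v \<noteq> a0" by blast
  from someI_ex[OF this] show ?thesis using True by (simp add: v0_def)
qed (simp add: v0_def a0)

lemma v0_eq: "v0 = a0 \<Longrightarrow> x \<in> pverts G \<Longrightarrow> x = a0"
proof (rule ccontr)
  assume "v0 = a0" "x \<in> pverts G" "x \<noteq> a0"
  then have ex: "\<exists>v. v \<in> pverts G \<and> v \<noteq> a0" by blast
  then have "v0 = (SOME v. v \<in> pverts G \<and> v \<noteq> a0)" unfolding v0_def by auto
  then show False using someI_ex[OF ex] \<open>v0 = a0\<close> by simp
qed

section \<open>The joint strategy\<close>

definition place :: "'b \<times> 'a \<times> 'a option list \<times> 'b option list \<Rightarrow> ('a \<times> 'b) list" where
  "place = (\<lambda>(u, v, H, K). map (\<lambda>a. (a, u)) (\<sigma> H) @ map (\<lambda>b. (v, b)) (\<tau> K))"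

text \<open>
  Team A withholds its move if otherwise all cops might meet on the vertex \<open>(a0, b0)\<close> before the
  robber has been in the row of team A or in the column of team B.
\<close>

definition advance :: "'b \<times> 'a \<times> 'a option list \<times> 'b option list \<Rightarrow> 'a \<times> 'b \<Rightarrow> 'a \<times> 'b \<Rightarrow>
    'b \<times> 'a \<times> 'a option list \<times> 'b option list" where
  "advance = (\<lambda>(u, v, H, K) p q.
     let seen = observe N (place (u, v, H, K)) q \<noteq> None;
       v' = (if v = fst q \<or> \<not> seen \<and> u = snd q then v else toward G v (fst q));
       u' = (if u = snd q \<or> \<not> seen \<and> v = fst q then u else toward J u (snd q))
     in (if v' = a0 \<and> u' = b0 \<and> v' \<noteq> fst q \<and> u' \<noteq> snd q then u else u', v',
         if u = snd q then extend_history G \<sigma> H (fst p) (fst q) else H,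
         if v = fst q then extend_history J \<tau> K (snd p) (snd q) else K))"

text \<open>For \<open>t = 0\<close> the argument \<open>r (t - 1)\<close> is \<open>r 0\<close>,
  which is harmless: it only enters \<open>extend_history\<close>, which ignores it while the
  histories are empty.\<close>

primrec state where
  "state r 0 = (b0, v0, [], [])"
| "state r (Suc t) = advance (state r t) (r (t - 1)) (r t)"

definition row where "row r t = fst (state r t)"
definition col where "col r t = fst (snd (state r t))"
definition hA where "hA r t = fst (snd (snd (state r t)))"
definition hB where "hB r t = snd (snd (snd (state r t)))"
definition squad where "squad r t = place (state r t)"

lemma state_eq: "state r t = (row r t, col r t, hA r t, hB r t)"
  by (simp add: row_def col_def hA_def hB_def)

lemma squad_eq:
  "squad r t = map (\<lambda>a. (a, row r t)) (\<sigma> (hA r t)) @ map (\<lambda>b. (col r t, b)) (\<tau> (hB r t))"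
  unfolding squad_def place_def row_def col_def hA_def hB_def by (simp split: prod.split)

definition seen where "seen r t \<longleftrightarrow> observe N (squad r t) (r t) \<noteq> None"

text \<open>The row team A aims for, before the rule of withholding its move is applied.\<close>

definition row_next where
  "row_next r t = (if row r t = snd (r t) \<or> \<not> seen r t \<and> col r t = fst (r t) then row r t
     else toward J (row r t) (snd (r t)))"

lemma state_0: "row r 0 = b0" "col r 0 = v0" "hA r 0 = []" "hB r 0 = []"
  by (simp_all add: row_def col_def hA_def hB_def)

lemma state_Suc:
  "state r (Suc t) = advance (row r t, col r t, hA r t, hB r t) (r (t - 1)) (r t)"
  by (simp only: state.simps state_eq[of r t])

lemma seen_eq:
  "seen r t \<longleftrightarrow> observe N (place (row r t, col r t, hA r t, hB r t)) (r t) \<noteq> None"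
  by (simp add: seen_def squad_def state_eq)

lemma col_Suc:
  "col r (Suc t) = (if col r t = fst (r t) \<or> \<not> seen r t \<and> row r t = snd (r t) then col r t
     else toward G (col r t) (fst (r t)))"
  unfolding col_def[of r "Suc t"] state_Suc seen_eq advance_def Let_def prod.case fst_conv snd_conv
  by (rule refl)

lemma row_Suc:
  "row r (Suc t) = (if col r (Suc t) = a0 \<and> row_next r t = b0 \<and>
     col r (Suc t) \<noteq> fst (r t) \<and> row_next r t \<noteq> snd (r t) then row r t else row_next r t)"
  unfolding col_Suc row_next_def
  unfolding row_def[of r "Suc t"] state_Suc seen_eq advance_def Let_def prod.case fst_conv snd_conv
  by (rule refl)

lemma hA_Suc: "hA r (Suc t) = (if row r t = snd (r t)
    then extend_history G \<sigma> (hA r t) (fst (r (t - 1))) (fst (r t)) else hA r t)"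
  unfolding hA_def[of r "Suc t"] state_Suc advance_def Let_def prod.case fst_conv snd_conv
  by (rule refl)

lemma hB_Suc: "hB r (Suc t) = (if col r t = fst (r t)
    then extend_history J \<tau> (hB r t) (snd (r (t - 1))) (snd (r t)) else hB r t)"
  unfolding hB_def[of r "Suc t"] state_Suc advance_def Let_def prod.case fst_conv snd_conv
  by (rule refl)

lemma robber_coords:
  assumes "robber_play N r"
  shows "fst (r t) \<in> pverts G" "snd (r t) \<in> pverts J"
    and "step G (fst (r t)) (fst (r (Suc t)))" "step J (snd (r t)) (snd (r (Suc t)))"
    and "fst (r t) = fst (r (Suc t)) \<or> snd (r t) = snd (r (Suc t))"
proof -
  have "step N (r t) (r (Suc t))" using assms by (simp add: robber_play_def)
  from this[unfolded step_iff] show "fst (r t) \<in> pverts G" "snd (r t) \<in> pverts J"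
    "step G (fst (r t)) (fst (r (Suc t)))" "step J (snd (r t)) (snd (r (Suc t)))"
    "fst (r t) = fst (r (Suc t)) \<or> snd (r t) = snd (r (Suc t))"
    by (auto simp: step_def)
qed

lemma row_col_verts:
  assumes "robber_play N r"
  shows "row r t \<in> pverts J \<and> col r t \<in> pverts G"
proof (induction t)
  case 0
  then show ?case by (simp add: state_0 v0 b0)
next
  case (Suc t)
  then have "row_next r t \<in> pverts J" "col r (Suc t) \<in> pverts G"
    using robber_coords(1,2)[OF assms, of t]
    by (auto simp: row_next_def col_Suc G.toward_in_verts J.toward_in_verts)
  then show ?case using Suc by (simp add: row_Suc)
qed

lemma row_step:
  assumes "robber_play N r"
  shows "step J (row r t) (row r (Suc t))" "step G (col r t) (col r (Suc t))"
proof -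
  have v: "row r t \<in> pverts J" "col r t \<in> pverts G" using row_col_verts[OF assms] by auto
  have "step J (row r t) (row_next r t)"
    using v robber_coords(1,2)[OF assms, of t]
    by (auto simp: row_next_def step_def J.toward_in_verts J.toward)
  then show "step J (row r t) (row r (Suc t))"
    using v by (auto simp: row_Suc step_refl)
  show "step G (col r t) (col r (Suc t))"
    using v robber_coords(1,2)[OF assms, of t]
    by (auto simp: col_Suc step_def G.toward_in_verts G.toward)
qed

lemma row_act: "row r t = snd (r t) \<Longrightarrow> row r (Suc t) = row r t"
  by (auto simp: row_Suc row_next_def)

section \<open>The simulated games and their invariant\<close>

lemma game_A:
  assumes "robber_play N r"
  shows "intermittent_game G k \<sigma> (\<lambda>t. fst (r t)) (\<lambda>t. row r t = snd (r t)) (hA r)"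
  using robber_coords[OF assms] \<sigma>_legal by unfold_locales (auto simp: state_0 hA_Suc)

lemma game_B:
  assumes "robber_play N r"
  shows "intermittent_game J m \<tau> (\<lambda>t. snd (r t)) (\<lambda>t. col r t = fst (r t)) (hB r)"
  using robber_coords[OF assms] \<tau>_legal by unfold_locales (auto simp: state_0 hB_Suc)

text \<open>The cops have made their move of the round and the robber has not: team A is then in his
  row. The guard \<open>0 < t\<close> is needed because \<open>t - 1\<close> would denote the
  current vertex at the start.\<close>

definition in_row where "in_row r t \<longleftrightarrow> 0 < t \<and> row r t = snd (r (t - 1))"
definition in_col where "in_col r t \<longleftrightarrow> 0 < t \<and> col r t = fst (r (t - 1))"

text \<open>A move changes only one coordinate. So leaving the row keeps the first coordinate, which
  is what an idle round of the game in \<open>G\<close> requires.\<close>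

lemma idle_row:
  assumes "robber_play N r" "in_row r t" "row r t \<noteq> snd (r t)"
  shows "fst (r t) = fst (r (t - 1))" "(row r t, snd (r t)) \<in> parcs J"
  using assms robber_coords(4,5)[OF assms(1), of "t - 1"]
  by (auto simp: in_row_def step_def)

lemma idle_col:
  assumes "robber_play N r" "in_col r t" "col r t \<noteq> fst (r t)"
  shows "snd (r t) = snd (r (t - 1))" "(col r t, fst (r t)) \<in> parcs G"
  using assms robber_coords(3,5)[OF assms(1), of "t - 1"]
  by (auto simp: in_col_def step_def)

lemma uncaught_squad:
  assumes "uncaught (squad r) r t" "0 < t"
  shows "r (t - 1) \<notin> set (squad r t)"
  using assms unfolding uncaught_def by (cases t) auto

text \<open>Outside the row, the robber can be adjacent to a cop of team A only if they share the
  first coordinate. Having just left the row, he would have stood on the vertex of that cop before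
  his move.\<close>

lemma in_row_seen:
  assumes "robber_play N r" "uncaught (squad r) r t" "\<sigma> (hA r t) \<noteq> []"
    and "in_row r t" "row r t \<noteq> snd (r t)"
  shows "seen r t"
proof -
  obtain a where a: "a \<in> set (\<sigma> (hA r t))" using assms(3) by (meson list.set_sel(1))
  then have sq: "(a, row r t) \<in> set (squad r t)" by (auto simp: squad_eq)
  moreover have "r (t - 1) \<notin> set (squad r t)"
    using uncaught_squad[OF assms(2)] assms(4) by (simp add: in_row_def)
  ultimately have "a \<noteq> fst (r (t - 1))"
    using assms(4) by (auto simp: in_row_def)
  then have "((a, row r t), r t) \<notin> parcs N"
    using idle_row[OF assms(1,4,5)] assms(5) by (cases "r t") (auto simp: arc_iff)
  then show ?thesis using sq by (auto simp: seen_def observe_None_iff)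
qed

lemma in_col_seen:
  assumes "robber_play N r" "uncaught (squad r) r t" "\<tau> (hB r t) \<noteq> []"
    and "in_col r t" "col r t \<noteq> fst (r t)"
  shows "seen r t"
proof -
  obtain b where b: "b \<in> set (\<tau> (hB r t))" using assms(3) by (meson list.set_sel(1))
  then have sq: "(col r t, b) \<in> set (squad r t)" by (auto simp: squad_eq)
  moreover have "r (t - 1) \<notin> set (squad r t)"
    using uncaught_squad[OF assms(2)] assms(4) by (simp add: in_col_def)
  ultimately have "b \<noteq> snd (r (t - 1))"
    using assms(4) by (auto simp: in_col_def)
  then have "((col r t, b), r t) \<notin> parcs N"
    using idle_col[OF assms(1,4,5)] assms(5) by (cases "r t") (auto simp: arc_iff)
  then show ?thesis using sq by (auto simp: seen_def observe_None_iff)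
qed

lemma unseen_A: "\<not> seen r t \<Longrightarrow> a \<in> set (\<sigma> (hA r t)) \<Longrightarrow>
    a = fst (r t) \<and> (row r t, snd (r t)) \<in> parcs J \<or>
    row r t = snd (r t) \<and> (a, fst (r t)) \<in> parcs G"
  by (cases "r t") (force simp: seen_def observe_None_iff squad_eq arc_iff)

lemma unseen_B: "\<not> seen r t \<Longrightarrow> b \<in> set (\<tau> (hB r t)) \<Longrightarrow>
    b = snd (r t) \<and> (col r t, fst (r t)) \<in> parcs G \<or>
    col r t = fst (r t) \<and> (b, snd (r t)) \<in> parcs J"
  by (cases "r t") (force simp: seen_def observe_None_iff squad_eq arc_iff)

text \<open>Outside the row, adjacency to the cop \<open>(a0, row r t)\<close> forces the first
  coordinate \<open>a0\<close>; outside the column, adjacency to \<open>(col r t, b0)\<close> forces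
  the second coordinate \<open>b0\<close>.\<close>

lemma unseen_idle_position:
  assumes "\<not> seen r t" "hA r t = []" "hB r t = []" "row r t \<noteq> snd (r t)" "col r t \<noteq> fst (r t)"
  shows "r t = (a0, b0)" "(row r t, snd (r t)) \<in> parcs J" "(col r t, fst (r t)) \<in> parcs G"
  using unseen_A[OF assms(1), of a0] unseen_B[OF assms(1), of b0] assms a0 b0
  by (auto simp: prod_eq_iff)

text \<open>Once a team has begun its game, each of its moves ends in the row or column of the
  robber. The last clause keeps the two reference cops apart as long as neither team is there, since
  coinciding cops would not tell row from column.\<close>

definition coherent where
  "coherent r t \<longleftrightarrow> (hA r t \<noteq> [] \<longrightarrow> in_row r t) \<and> (hB r t \<noteq> [] \<longrightarrow> in_col r t) \<and>
     (0 < t \<longrightarrow> in_row r t \<or> in_col r t \<or> (col r t, row r t) \<noteq> (a0, b0))"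

lemma teams:
  assumes r: "robber_play N r" and coh: "\<And>s. s < t \<Longrightarrow> coherent r s"
  shows "length (\<sigma> (hA r t)) = k \<and> set (\<sigma> (hA r t)) \<subseteq> pverts G"
    and "length (\<tau> (hB r t)) = m \<and> set (\<tau> (hB r t)) \<subseteq> pverts J"
  using intermittent_game.position_verts[OF game_A[OF r], of t]
    intermittent_game.position_verts[OF game_B[OF r], of t]
    coh idle_row[OF r] idle_col[OF r] unfolding coherent_def by blast+

text \<open>If the robber leaves the row, he is visible and in an adjacent row, which team A enters
  at once. The move is not withheld, as it ends in his row.\<close>

lemma in_row_Suc:
  assumes r: "robber_play N r" and "uncaught (squad r) r t" "\<And>s. s < t \<Longrightarrow> coherent r s"
    and "in_row r t"
  shows "in_row r (Suc t)"
proof (cases "row r t = snd (r t)")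
  case True
  then show ?thesis using row_act[of r t] by (simp add: in_row_def)
next
  case False
  have "\<sigma> (hA r t) \<noteq> []" using teams(1)[OF r assms(3)] k_pos by auto
  then have "seen r t" using in_row_seen r assms(2,4) False by blast
  then show ?thesis
    using False J.toward_adjacent[OF idle_row(2)[OF r assms(4) False]]
    by (simp add: in_row_def row_Suc row_next_def)
qed

lemma in_col_Suc:
  assumes r: "robber_play N r" and "uncaught (squad r) r t" "\<And>s. s < t \<Longrightarrow> coherent r s"
    and "in_col r t"
  shows "in_col r (Suc t)"
proof (cases "col r t = fst (r t)")
  case True
  then show ?thesis by (simp add: in_col_def col_Suc)
next
  case False
  have "\<tau> (hB r t) \<noteq> []" using teams(2)[OF r assms(3)] m_pos by auto
  then have "seen r t" using in_col_seen r assms(2,4) False by blast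
  then show ?thesis
    using False G.toward_adjacent[OF idle_col(2)[OF r assms(4) False]]
    by (simp add: in_col_def col_Suc)
qed

lemma coherent:
  assumes r: "robber_play N r" and "uncaught (squad r) r t"
  shows "coherent r t"
  using assms(2)
proof (induction t rule: less_induct)
  case (less t)
  show ?case
  proof (cases t)
    case 0
    then show ?thesis by (simp add: coherent_def state_0)
  next
    case (Suc n)
    have un: "uncaught (squad r) r n" using less.prems Suc uncaught_mono by fastforce
    have coh: "coherent r s" if "s < Suc n" for s
      using that less.IH[of s] less.prems Suc uncaught_mono[of "squad r" r t s] by simp
    have "in_row r (Suc n)" if "hA r (Suc n) \<noteq> []"
    proof (cases "row r n = snd (r n)")
      case True
      then show ?thesis using row_act[of r n] by (simp add: in_row_def)
    next
      case False
      then show ?thesis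
        using that coh[of n] in_row_Suc[OF r un] coh by (simp add: coherent_def hA_Suc)
    qed
    moreover have "in_col r (Suc n)" if "hB r (Suc n) \<noteq> []"
    proof (cases "col r n = fst (r n)")
      case True
      then show ?thesis by (simp add: in_col_def col_Suc)
    next
      case False
      then show ?thesis
        using that coh[of n] in_col_Suc[OF r un] coh by (simp add: coherent_def hB_Suc)
    qed
    moreover have "(col r (Suc n), row r (Suc n)) \<noteq> (a0, b0)"
      if not_in: "\<not> in_row r (Suc n)" "\<not> in_col r (Suc n)"
    proof
      assume eq: "(col r (Suc n), row r (Suc n)) = (a0, b0)"
      have no_act: "row r n \<noteq> snd (r n)" "col r n \<noteq> fst (r n)"
        using not_in row_act[of r n] col_Suc[of r n] by (auto simp: in_row_def in_col_def)
      \<comment> \<open>If the planned row is \<open>b0\<close>, the move is withheld and the team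
        stays in another row; otherwise it does not reach \<open>b0\<close>. So the meeting at
        \<open>(a0, b0)\<close> cannot occur.\<close>
      have neq: "row_next r n \<noteq> row r n"
        using no_act J.toward_neq row_col_verts[OF r] robber_coords(2)[OF r]
        by (simp add: row_next_def)
      show False
        using eq not_in neq by (auto simp: row_Suc in_row_def in_col_def split: if_splits)
    qed
    ultimately show ?thesis unfolding coherent_def Suc by blast
  qed
qed

section \<open>Deductions about an invisible robber\<close>

lemma teams_nonempty:
  assumes r: "robber_play N r" and "uncaught (squad r) r t"
  shows "\<sigma> (hA r t) \<noteq> []" "\<tau> (hB r t) \<noteq> []"
proof -
  have "coherent r s" if "s < t" for s
    using coherent[OF r uncaught_mono[OF assms(2)], of s] that by simp
  then show "\<sigma> (hA r t) \<noteq> []" "\<tau> (hB r t) \<noteq> []"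
    using teams[OF r, of t] k_pos m_pos by auto
qed

lemma unseen_row:
  assumes r: "robber_play N r" and un: "uncaught (squad r) r t" and "\<not> seen r t" "in_row r t"
  shows "row r t = snd (r t)"
  using in_row_seen[OF r un teams_nonempty(1)[OF r un]] assms by blast

lemma unseen_col:
  assumes r: "robber_play N r" and un: "uncaught (squad r) r t" and "\<not> seen r t" "in_col r t"
  shows "col r t = fst (r t)"
  using in_col_seen[OF r un teams_nonempty(2)[OF r un]] assms by blast

text \<open>
  The right-hand sides depend only on what the cops know: this is why they can follow their plan
  against an invisible robber.
\<close>

lemma unseen_acts:
  assumes r: "robber_play N r" and un: "uncaught (squad r) r t" and ns: "\<not> seen r t"
  shows "row r t = snd (r t) \<longleftrightarrow>
      (if t = 0 then v0 \<noteq> a0 else in_row r t \<or> (if in_col r t then col r t \<noteq> a0 else row r t = b0))"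
    and "col r t = fst (r t) \<longleftrightarrow>
      (if t = 0 then v0 = a0 else in_col r t \<or> (if in_row r t then row r t \<noteq> b0 else col r t = a0))"
proof -
  note A = unseen_A[OF ns, of a0]
  note B = unseen_B[OF ns, of b0]
  have coh: "coherent r t" by (rule coherent[OF r un])
  have *: "(row r t = snd (r t) \<longleftrightarrow>
      (if t = 0 then v0 \<noteq> a0 else in_row r t \<or> (if in_col r t then col r t \<noteq> a0 else row r t = b0)))
    \<and> (col r t = fst (r t) \<longleftrightarrow>
      (if t = 0 then v0 = a0 else in_col r t \<or> (if in_row r t then row r t \<noteq> b0 else col r t = a0)))"
  proof (cases "t = 0")
    case True
    \<comment> \<open>If \<open>v0 = a0\<close>, then \<open>G\<close> has a single vertex.
      Otherwise the reference cops are distinct and both in row \<open>b0\<close>, and only a robber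
      in this row is adjacent to both without being in column \<open>v0\<close>.\<close>
    then have "v0 = a0 \<Longrightarrow> fst (r t) = a0"
      using v0_eq robber_coords(1)[OF r] by blast
    then show ?thesis
      using True A B a0 b0 G.no_loop J.no_loop by (auto simp: state_0)
  next
    case False
    consider "in_row r t" "in_col r t" | "in_row r t" "\<not> in_col r t"
      | "\<not> in_row r t" "in_col r t" | "\<not> in_row r t" "\<not> in_col r t" by blast
    then show ?thesis
    proof cases
      case 1
      then show ?thesis using unseen_row[OF r un ns] unseen_col[OF r un ns] False by auto
    next
      case 2
      \<comment> \<open>The reference cop of team B is at \<open>(col r t, b0)\<close> and the
        robber is in row \<open>row r t\<close>. If this row is \<open>b0\<close>, adjacency puts
        him in another column than the cop, otherwise in the same one.\<close>
      then have "hB r t = []" using coh by (auto simp: coherent_def)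
      then have "b0 = snd (r t) \<and> (col r t, fst (r t)) \<in> parcs G \<or>
          col r t = fst (r t) \<and> (b0, snd (r t)) \<in> parcs J"
        using B b0 by simp
      moreover have "row r t = snd (r t)" using unseen_row[OF r un ns 2(1)] .
      ultimately have "col r t = fst (r t) \<longleftrightarrow> row r t \<noteq> b0" "row r t = snd (r t)"
        using G.no_loop J.no_loop by metis+
      then show ?thesis
        by (simp only: 2 False simp_thms if_True if_False)
    next
      case 3
      then have "hA r t = []" using coh by (auto simp: coherent_def)
      then have "a0 = fst (r t) \<and> (row r t, snd (r t)) \<in> parcs J \<or>
          row r t = snd (r t) \<and> (a0, fst (r t)) \<in> parcs G"
        using A a0 by simp
      moreover have "col r t = fst (r t)" using unseen_col[OF r un ns 3(2)] .
      ultimately have "row r t = snd (r t) \<longleftrightarrow> col r t \<noteq> a0" "col r t = fst (r t)"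
        using G.no_loop J.no_loop by metis+
      then show ?thesis
        by (simp only: 3 False simp_thms if_True if_False)
    next
      case 4
      then have h: "hA r t = []" "hB r t = []" and ne: "\<not> (col r t = a0 \<and> row r t = b0)"
        using coh False by (auto simp: coherent_def)
      \<comment> \<open>Entering the row and the column in one move would change both
        coordinates.\<close>
      have "\<not> (row r t = snd (r t) \<and> col r t = fst (r t))"
        using 4 False robber_coords(5)[OF r, of "t - 1"] by (auto simp: in_row_def in_col_def)
      moreover have "a0 = fst (r t) \<and> (row r t, snd (r t)) \<in> parcs J \<or>
          row r t = snd (r t) \<and> (a0, fst (r t)) \<in> parcs G"
        using A a0 h by simp
      moreover have "b0 = snd (r t) \<and> (col r t, fst (r t)) \<in> parcs G \<or>
          col r t = fst (r t) \<and> (b0, snd (r t)) \<in> parcs J"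
        using B b0 h by simp
      ultimately have "row r t = snd (r t) \<longleftrightarrow> row r t = b0" "col r t = fst (r t) \<longleftrightarrow> col r t = a0"
        using ne G.no_loop J.no_loop by metis+
      then show ?thesis
        by (simp only: 4 False simp_thms if_True if_False)
    qed
  qed
  show "row r t = snd (r t) \<longleftrightarrow>
      (if t = 0 then v0 \<noteq> a0 else in_row r t \<or> (if in_col r t then col r t \<noteq> a0 else row r t = b0))"
    using * by blast
  show "col r t = fst (r t) \<longleftrightarrow>
      (if t = 0 then v0 = a0 else in_col r t \<or> (if in_row r t then row r t \<noteq> b0 else col r t = a0))"
    using * by blast
qed

text \<open>A team that plays its game keeps its row or column, and the other team waits; so the
  unknown coordinate of the robber does not influence the lines.\<close>

lemma unseen_act_stay:
  assumes "\<not> seen r t" "row r t = snd (r t) \<or> col r t = fst (r t)"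
  shows "row r (Suc t) = row r t" "col r (Suc t) = col r t"
proof -
  show c: "col r (Suc t) = col r t" using assms by (auto simp: col_Suc)
  have "row_next r t = row r t" using assms by (auto simp: row_next_def)
  then show "row r (Suc t) = row r t" by (simp add: row_Suc)
qed

text \<open>A team that has begun its game would have been in his row or column before his move, and
  leaving it would have made him visible.\<close>

lemma unseen_idle:
  assumes r: "robber_play N r" and un: "uncaught (squad r) r t" and ns: "\<not> seen r t"
    and "row r t \<noteq> snd (r t)" "col r t \<noteq> fst (r t)"
  shows "hA r t = []" "hB r t = []"
  using coherent[OF r un] unseen_row[OF r un ns] unseen_col[OF r un ns] assms(4,5)
  unfolding coherent_def by blast+

section \<open>Equal observations force equal moves\<close>

lemma observe_in_row:
  assumes "observe N (squad r t) p = None" "row r t = snd p"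
  shows "observe G (\<sigma> (hA r t)) (fst p) = None"
  using assms J.no_loop by (cases p) (force simp: observe_None_iff squad_eq arc_iff)

lemma observe_in_col:
  assumes "observe N (squad r t) p = None" "col r t = fst p"
  shows "observe J (\<tau> (hB r t)) (snd p) = None"
  using assms G.no_loop by (cases p) (force simp: observe_None_iff squad_eq arc_iff)

text \<open>A visible robber is known exactly, and an invisible one in the row or column is
  invisible in the simulated game too. So a team can compute its simulated observation.\<close>

lemma same_observation:
  assumes "state r t = state r' t" "observe N (squad r t) p = observe N (squad r' t) p'"
  shows "row r t = snd p \<Longrightarrow> row r' t = snd p' \<Longrightarrow>
      observe G (\<sigma> (hA r t)) (fst p) = observe G (\<sigma> (hA r' t)) (fst p')"
    and "col r t = fst p \<Longrightarrow> col r' t = fst p' \<Longrightarrow>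
      observe J (\<tau> (hB r t)) (snd p) = observe J (\<tau> (hB r' t)) (snd p')"
proof -
  have eq: "hA r t = hA r' t" "hB r t = hB r' t" "squad r t = squad r' t"
    using assms(1) by (simp_all add: hA_def hB_def squad_def)
  show "observe G (\<sigma> (hA r t)) (fst p) = observe G (\<sigma> (hA r' t)) (fst p')"
    if "row r t = snd p" "row r' t = snd p'"
  proof (cases "observe N (squad r t) p = None")
    case True
    then show ?thesis
      using observe_in_row[OF True that(1)] observe_in_row[of r' t p'] that assms(2) by simp
  next
    case False
    then have "p = p'" using observe_Some_eq assms(2) eq(3) by metis
    then show ?thesis using eq by simp
  qed
  show "observe J (\<tau> (hB r t)) (snd p) = observe J (\<tau> (hB r' t)) (snd p')"
    if "col r t = fst p" "col r' t = fst p'"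
  proof (cases "observe N (squad r t) p = None")
    case True
    then show ?thesis
      using observe_in_col[OF True that(1)] observe_in_col[of r' t p'] that assms(2) by simp
  next
    case False
    then have "p = p'" using observe_Some_eq assms(2) eq(3) by metis
    then show ?thesis using eq by simp
  qed
qed

text \<open>Besides the state, the cops have to remember \<open>in_row\<close> and
  \<open>in_col\<close>, because \<open>unseen_acts\<close> uses them to interpret an invisible
  robber; hence these are part of the induction.\<close>

lemma state_Suc_eq:
  assumes r: "robber_play N r" "robber_play N r'"
    and un: "uncaught (squad r) r t" "uncaught (squad r') r' t"
    and st: "state r t = state r' t" "in_row r t \<longleftrightarrow> in_row r' t" "in_col r t \<longleftrightarrow> in_col r' t"
    and past: "0 < t \<Longrightarrow>
      observe N (squad r t) (r (t - 1)) = observe N (squad r' t) (r' (t - 1))"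
    and now: "observe N (squad r t) (r t) = observe N (squad r' t) (r' t)"
  shows "state r (Suc t) = state r' (Suc t)"
    and "in_row r (Suc t) \<longleftrightarrow> in_row r' (Suc t)" "in_col r (Suc t) \<longleftrightarrow> in_col r' (Suc t)"
proof -
  have eq: "row r t = row r' t" "col r t = col r' t" "hA r t = hA r' t" "hB r t = hB r' t"
    "squad r t = squad r' t"
    using st(1) by (simp_all add: row_def col_def hA_def hB_def squad_def)
  have s: "seen r t \<longleftrightarrow> seen r' t" using now by (simp add: seen_def)
  have same: "r t = r' t" if "seen r t"
    using that now eq(5) observe_Some_eq unfolding seen_def by metis
  have acts: "(row r t = snd (r t) \<longleftrightarrow> row r' t = snd (r' t)) \<and>
      (col r t = fst (r t) \<longleftrightarrow> col r' t = fst (r' t))"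
  proof (cases "seen r t")
    case True
    then show ?thesis using same eq by simp
  next
    case False
    then show ?thesis
      using unseen_acts[OF r(1) un(1)] unseen_acts[OF r(2) un(2)] s st eq by simp
  qed
  \<comment> \<open>The cops know the vertex of the robber, either by seeing him or because he can
    only be on \<open>(a0, b0)\<close>, unless he hides in a row or column where nothing more is
    needed.\<close>
  have pos: "r t = r' t \<or> \<not> seen r t \<and> (row r t = snd (r t) \<or> col r t = fst (r t))"
  proof (rule ccontr)
    assume "\<not> ?thesis"
    then have *: "r t \<noteq> r' t" "\<not> seen r t" "row r t \<noteq> snd (r t)" "col r t \<noteq> fst (r t)"
      using same by auto
    then have "r t = (a0, b0)" "r' t = (a0, b0)"
      using unseen_idle_position(1) unseen_idle[OF r(1) un(1)] unseen_idle[OF r(2) un(2)] acts s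
      by (metis, metis)
    then show False using * by simp
  qed
  have rc: "row r (Suc t) = row r' (Suc t) \<and> col r (Suc t) = col r' (Suc t)"
    using pos
  proof
    assume "r t = r' t"
    then show ?thesis
      unfolding row_Suc row_next_def col_Suc by (simp only: eq s simp_thms)
  next
    assume "\<not> seen r t \<and> (row r t = snd (r t) \<or> col r t = fst (r t))"
    then show ?thesis
      using unseen_act_stay[of r t] unseen_act_stay[of r' t] s acts eq by auto
  qed
  have "hA r (Suc t) = hA r' (Suc t)"
  proof (cases "row r t = snd (r t)")
    case True
    then have "observe G (\<sigma> (hA r t)) (fst (r t)) = observe G (\<sigma> (hA r' t)) (fst (r' t))"
      using same_observation(1)[OF st(1) now] acts by blast
    \<comment> \<open>A game already begun also records the robber before his move. He was then in
      the row by \<open>coherent\<close>, so this observation can be simulated as well.\<close>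
    moreover have "observe G (\<sigma> (hA r t)) (fst (r (t - 1))) =
        observe G (\<sigma> (hA r' t)) (fst (r' (t - 1)))" if "hA r t \<noteq> []"
    proof -
      have "in_row r t" "in_row r' t"
        using that coherent[OF r(1) un(1)] st(2) by (auto simp: coherent_def)
      then show ?thesis
        using same_observation(1)[OF st(1) past] by (simp add: in_row_def)
    qed
    ultimately show ?thesis
      using True acts eq by (auto simp: hA_Suc extend_history_def state_0)
  qed (use acts eq in \<open>auto simp: hA_Suc\<close>)
  moreover have "hB r (Suc t) = hB r' (Suc t)"
  proof (cases "col r t = fst (r t)")
    case True
    then have "observe J (\<tau> (hB r t)) (snd (r t)) = observe J (\<tau> (hB r' t)) (snd (r' t))"
      using same_observation(2)[OF st(1) now] acts by blast
    moreover have "observe J (\<tau> (hB r t)) (snd (r (t - 1))) =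
        observe J (\<tau> (hB r' t)) (snd (r' (t - 1)))" if "hB r t \<noteq> []"
    proof -
      have "in_col r t" "in_col r' t"
        using that coherent[OF r(1) un(1)] st(3) by (auto simp: coherent_def)
      then show ?thesis
        using same_observation(2)[OF st(1) past] by (simp add: in_col_def)
    qed
    ultimately show ?thesis
      using True acts eq by (auto simp: hB_Suc extend_history_def state_0)
  qed (use acts eq in \<open>auto simp: hB_Suc\<close>)
  ultimately show "state r (Suc t) = state r' (Suc t)"
    using rc by (simp add: state_eq[of _ "Suc t"] del: state.simps)
  have "(row r (Suc t) = snd (r t) \<longleftrightarrow> row r' (Suc t) = snd (r' t)) \<and>
      (col r (Suc t) = fst (r t) \<longleftrightarrow> col r' (Suc t) = fst (r' t))"
    using pos
  proof
    assume "r t = r' t"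
    then show ?thesis using rc by simp
  next
    assume "\<not> seen r t \<and> (row r t = snd (r t) \<or> col r t = fst (r t))"
    then show ?thesis
      using unseen_act_stay[of r t] unseen_act_stay[of r' t] s acts by auto
  qed
  then show "in_row r (Suc t) \<longleftrightarrow> in_row r' (Suc t)" "in_col r (Suc t) \<longleftrightarrow> in_col r' (Suc t)"
    by (auto simp: in_row_def in_col_def)
qed

lemma state_nonanticipating:
  assumes r: "robber_play N r" "robber_play N r'"
    and "uncaught (squad r) r t" "uncaught (squad r') r' t"
    and "observations N (squad r) r t = observations N (squad r') r' t"
  shows "state r (Suc t) = state r' (Suc t) \<and> (in_row r (Suc t) \<longleftrightarrow> in_row r' (Suc t)) \<and>
    (in_col r (Suc t) \<longleftrightarrow> in_col r' (Suc t))"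
  using assms(3-)
proof (induction t)
  case 0
  then show ?case
    using state_Suc_eq[OF r, of 0] by (simp add: in_row_def in_col_def del: state.simps(2))
next
  case (Suc t)
  note D = observations_SucD[OF Suc.prems(3)]
  have "uncaught (squad r) r t" "uncaught (squad r') r' t"
    using Suc.prems uncaught_mono by (metis le_SucI order_refl)+
  then show ?case
    using Suc.IH[OF _ _ D(1)] state_Suc_eq[OF r Suc.prems(1,2)] D(2,3)
    by (simp del: state.simps(2))
qed

section \<open>Legality of the moves and capture\<close>

lemma squad_step:
  assumes r: "robber_play N r" and un: "uncaught (squad r) r t"
  shows "list_all2 (step N) (squad r t) (squad r (Suc t))"
proof -
  have coh: "coherent r s" if "s \<le> t" for s
    using coherent[OF r uncaught_mono[OF un that]] .
  have A: "list_all2 (step G) (\<sigma> (hA r t)) (\<sigma> (hA r (Suc t)))"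
    using intermittent_game.position_step[OF game_A[OF r], of t] coh idle_row[OF r]
    unfolding coherent_def by blast
  have B: "list_all2 (step J) (\<tau> (hB r t)) (\<tau> (hB r (Suc t)))"
    using intermittent_game.position_step[OF game_B[OF r], of t] coh idle_col[OF r]
    unfolding coherent_def by blast
  note steps = row_step[OF r, of t]
  \<comment> \<open>A cop may change only one coordinate: when its game advances the row is fixed,
    and when the row may change the game is idle.\<close>
  have "list_all2 (step N) (map (\<lambda>a. (a, row r t)) (\<sigma> (hA r t)))
      (map (\<lambda>a. (a, row r (Suc t))) (\<sigma> (hA r (Suc t))))"
  proof (cases "row r t = snd (r t)")
    case True
    then show ?thesis
      using A steps row_act[of r t] by (auto simp: list.rel_map step_iff elim!: list_all2_mono)
  next
    case False
    then have "hA r (Suc t) = hA r t" by (simp add: hA_Suc)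
    moreover have "set (\<sigma> (hA r t)) \<subseteq> pverts G" using teams(1)[OF r] coh by simp
    ultimately show ?thesis
      using steps by (auto simp: list.rel_map step_iff step_refl intro!: list.rel_refl_strong)
  qed
  moreover have "list_all2 (step N) (map (\<lambda>b. (col r t, b)) (\<tau> (hB r t)))
      (map (\<lambda>b. (col r (Suc t), b)) (\<tau> (hB r (Suc t))))"
  proof (cases "col r t = fst (r t)")
    case True
    then have "col r (Suc t) = col r t" by (simp add: col_Suc)
    then show ?thesis
      using B steps by (auto simp: list.rel_map step_iff elim!: list_all2_mono)
  next
    case False
    then have "hB r (Suc t) = hB r t" by (simp add: hB_Suc)
    moreover have "set (\<tau> (hB r t)) \<subseteq> pverts J" using teams(2)[OF r] coh by simp
    ultimately show ?thesis
      using steps by (auto simp: list.rel_map step_iff step_refl intro!: list.rel_refl_strong)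
  qed
  ultimately show ?thesis unfolding squad_eq by (rule list_all2_appendI)
qed

text \<open>
  The last summand pays for the rounds in which team A withholds its move: this happens only when
  team B enters the column \<open>a0\<close>, which it leaves in the next round.
\<close>

definition potential where
  "potential r t = 2 * (gdist J (row r t) (snd (r (t - 1))) + gdist G (col r t) (fst (r (t - 1)))) +
     (if col r t = a0 then 0 else 1)"

text \<open>An invisible robber would be on \<open>(a0, b0)\<close>, where team A would catch him.
  Against a visible one, the distance sum grows by at most one through his move and drops by one per
  moving team. The factor 2 absorbs a change of the last summand; if team A withholds its move, the
  sum does not grow and that summand drops.\<close>

lemma potential_decreases:
  assumes r: "robber_play N r" and un: "uncaught (squad r) r (Suc t)" and t: "0 < t"
    and no_act: "row r t \<noteq> snd (r t)" "col r t \<noteq> fst (r t)"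
  shows "potential r (Suc t) < potential r t"
proof -
  have un': "uncaught (squad r) r t" using un by (simp add: uncaught_Suc)
  have seen: "seen r t"
  proof (rule ccontr)
    assume ns: "\<not> seen r t"
    note h = unseen_idle[OF r un' ns no_act]
    note p = unseen_idle_position[OF ns h no_act]
    have "row_next r t = snd (r t)"
      using J.toward_adjacent[OF p(2)] no_act by (simp add: row_next_def)
    then have "row r (Suc t) = snd (r t)" by (simp add: row_Suc)
    moreover have "hA r (Suc t) = []" using h no_act by (simp add: hA_Suc)
    ultimately have "r t \<in> set (squad r (Suc t))"
      using p(1) a0 by (auto simp: squad_eq)
    then show False using un by (simp add: uncaught_Suc)
  qed
  define u v x y where "u = row r t" and "v = col r t" and "x = fst (r t)" and "y = snd (r t)"
  have V: "u \<in> pverts J" "v \<in> pverts G" "x \<in> pverts G" "y \<in> pverts J"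
    using row_col_verts[OF r, of t] robber_coords[OF r, of t] by (auto simp: u_def v_def x_def y_def)
  have ne: "u \<noteq> y" "v \<noteq> x" using no_act by (auto simp: u_def v_def x_def y_def)
  define d where
    "d = gdist J u (snd (r (t - 1))) + gdist G v (fst (r (t - 1)))"
  have robber: "gdist J u y + gdist G v x \<le> Suc d"
  proof -
    have "step J (snd (r (t - 1))) y" "step G (fst (r (t - 1))) x"
      "fst (r (t - 1)) = x \<or> snd (r (t - 1)) = y"
      using robber_coords(3-5)[OF r, of "t - 1"] t by (auto simp: x_def y_def)
    then show ?thesis
      using J.gdist_arc[of "snd (r (t - 1))" y u] G.gdist_arc[of "fst (r (t - 1))" x v] V
      unfolding step_def d_def by auto
  qed
  have col': "col r (Suc t) = toward G v x"
    using seen no_act by (simp add: col_Suc v_def x_def)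
  have row': "row r (Suc t) = u \<and> toward G v x = a0 \<or> row r (Suc t) = toward J u y"
    using seen no_act col' by (auto simp: row_Suc row_next_def u_def y_def)
  have dG: "Suc (gdist G (toward G v x) x) = gdist G v x"
    using G.toward V ne by blast
  have dJ: "Suc (gdist J (toward J u y) y) = gdist J u y"
    using J.toward V ne by blast
  have pot: "potential r t = 2 * d + (if v = a0 then 0 else 1)"
    by (simp add: potential_def d_def u_def v_def)
  have pot': "potential r (Suc t) = 2 * (gdist J (row r (Suc t)) y + gdist G (toward G v x) x) +
      (if toward G v x = a0 then 0 else 1)"
    by (simp add: potential_def col' x_def y_def)
  show ?thesis
    using row'
  proof (elim disjE conjE)
    assume withheld: "row r (Suc t) = u" "toward G v x = a0"
    have "v \<noteq> a0" using G.toward_neq[OF V(2,3) ne(2)] withheld(2) by simp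
    moreover have "gdist J u y + gdist G (toward G v x) x \<le> d" using robber dG by linarith
    ultimately show ?thesis unfolding pot pot' using withheld by simp
  next
    assume "row r (Suc t) = toward J u y"
    then have "Suc (gdist J (row r (Suc t)) y + gdist G (toward G v x) x) \<le> d"
      using robber dG dJ by simp
    moreover have "2 * p + (if P then 0 else 1) < 2 * d + (if Q then 0 else 1)"
      if "Suc p \<le> d" for p :: nat and P Q
      using that by auto
    ultimately show ?thesis unfolding pot pot' by blast
  qed
qed

lemma squad_wins:
  assumes r: "robber_play N r"
  shows "\<exists>t. \<not> uncaught (squad r) r t"
proof (rule ccontr)
  assume "\<not> ?thesis"
  then have un: "uncaught (squad r) r t" for t by blast
  have coh: "coherent r t" for t using coherent[OF r un] .
  have not_in: "r t \<notin> set (squad r t)" "r t \<notin> set (squad r (Suc t))" for t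
    using un[of "Suc t"] un[of t] unfolding uncaught_def by auto
  have "finite {t. row r t = snd (r t)}"
  proof (rule ccontr)
    assume "infinite {t. row r t = snd (r t)}"
    then obtain t where t: "row r t = snd (r t)"
      "fst (r t) \<in> set (\<sigma> (hA r t)) \<or> fst (r t) \<in> set (\<sigma> (hA r (Suc t)))"
      using intermittent_game.capture_if_infinite[OF game_A[OF r]] coh idle_row[OF r] \<sigma>_win
      unfolding coherent_def by blast
    \<comment> \<open>The round is active, so the robber is in row \<open>row r t\<close> and team A
      keeps this row: agreement of the first coordinates is a real capture.\<close>
    then show False
      using not_in[of t] row_act[of r t] by (cases "r t") (auto simp: squad_eq)
  qed
  moreover have "finite {t. col r t = fst (r t)}"
  proof (rule ccontr)
    assume "infinite {t. col r t = fst (r t)}"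
    then obtain t where t: "col r t = fst (r t)"
      "snd (r t) \<in> set (\<tau> (hB r t)) \<or> snd (r t) \<in> set (\<tau> (hB r (Suc t)))"
      using intermittent_game.capture_if_infinite[OF game_B[OF r]] coh idle_col[OF r] \<tau>_win
      unfolding coherent_def by blast
    then show False
      using not_in[of t] col_Suc[of r t] by (cases "r t") (auto simp: squad_eq)
  qed
  ultimately have "finite ({t. row r t = snd (r t)} \<union> {t. col r t = fst (r t)})"
    by simp
  then obtain n where n: "\<forall>t\<in>{t. row r t = snd (r t)} \<union> {t. col r t = fst (r t)}. t < n"
    using finite_nat_set_iff_bounded by blast
  \<comment> \<open>From \<open>Suc n\<close> on neither team acts; the successor also ensures
    \<open>0 < t\<close>.\<close>
  have dec: "potential r (Suc t) < potential r t" if "Suc n \<le> t" for t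
  proof -
    have "row r t \<noteq> snd (r t)" "col r t \<noteq> fst (r t)" using n that
      by (metis (mono_tags) UnCI mem_Collect_eq not_less_eq_eq less_imp_le)+
    then show ?thesis using potential_decreases[OF r un, of t] that by simp
  qed
  have "potential r (Suc n + i) + i \<le> potential r (Suc n)" for i
  proof (induction i)
    case (Suc i)
    then show ?case using dec[of "Suc n + i"] by simp
  qed simp
  from this[of "Suc (potential r (Suc n))"] show False by simp
qed

theorem cops_win_product: "cops_win N (k + m)"
proof (rule cops_win_if_nonanticipating[where C = squad])
  show "squad r 0 = place (b0, v0, [], [])" for r
    by (simp add: squad_def)
  show "length (place (b0, v0, [], [])) = k + m"
    using initial by (simp add: place_def)
  show "set (place (b0, v0, [], [])) \<subseteq> pverts N"
    using initial v0 b0 by (auto simp: place_def cartesian_product_verts)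
  show "squad r (Suc t) = squad r' (Suc t)"
    if "robber_play N r" "robber_play N r'" "uncaught (squad r) r t" "uncaught (squad r') r' t"
      "observations N (squad r) r t = observations N (squad r') r' t" for r r' t
    using state_nonanticipating[OF that] unfolding squad_def by simp
qed (use N_no_loop squad_step squad_wins in auto)

end

theorem theorem5p3:
  fixes G :: "'a pair_pre_digraph" and J :: "'b pair_pre_digraph"
  assumes "pair_graph G" and "Digraph_Component.connected (with_proj G)"
    and "pair_graph J" and "Digraph_Component.connected (with_proj J)"
  shows "c\<^sub>H (G \<box> J) \<le> c\<^sub>H G + c\<^sub>H J"
proof -
  interpret G: connected_graph G
    using assms by (simp add: connected_graph_def connected_graph_axioms_def)
  interpret J: connected_graph J
    using assms by (simp add: connected_graph_def connected_graph_axioms_def)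
  obtain \<sigma> \<tau> where "legal_strategy G (c\<^sub>H G) \<sigma>" "\<forall>r. robber_play G r \<longrightarrow> captured G \<sigma> r"
    "legal_strategy J (c\<^sub>H J) \<tau>" "\<forall>r. robber_play J r \<longrightarrow> captured J \<tau> r"
    using G.hyperopic_cop_number_winning J.hyperopic_cop_number_winning
    unfolding cops_win_def by blast
  then interpret two_teams G J "c\<^sub>H G" "c\<^sub>H J" \<sigma> \<tau>
    by unfold_locales blast+
  show ?thesis
    unfolding hyperopic_cop_number_def[of "G \<box> J"] by (rule Least_le) (rule cops_win_product)
qed

end
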